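(* Let $p,q\geq 1$ and $\underline{s}\in S^{q-1}$. The generalized Cauchy-Kovalevskaya extension of the initial function $f_0(\underline{y})=e^{\langle\underline{y},\underline{s}\rangle}$, given by $$f(\underline{x},\underline{y})=\Gamma\big(\tfrac p2\big)\Big(\frac{|\underline{x}|}{2}\sqrt{\Delta_{\underline{y}}}\Big)^{-p/2}\Big(\frac{|\underline{x}|}{2}\sqrt{\Delta_{\underline{y}}}\,J_{\frac{p}{2}-1}(|\underline{x}|\sqrt{\Delta_{\underline{y}}})+\frac{\underline{x}\,\partial_{\underline{y}}}{2}J_{\frac{p}{2}}(|\underline{x}|\sqrt{\Delta_{\underline{y}}})\Big)f_{0}(\underline{y}),$$ is the plane wave $$f(\underline{x},\underline{y})=\frac{2^{\frac{p}{2}-1}\Gamma(\frac{p}{2})}{|\underline{x}|^{\frac{p}{2}-1}}\Big(J_{\frac{p}{2}-1}(|\underline{x}|) +J_{\frac{p}{2}}(|\underline{x}|) \frac{\underline{x}}{|\underline{x}|}\underline{s}\Big)e^{\langle\underline{y},\underline{s}\rangle},$$ the right-hand side being understood by continuous extension at $\underline{x}=\underline{0}$.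
   Context: $\mathbb{C}_{p+q}$ is the complex Clifford algebra with generators $e_1,\dots,e_{p+q}$ satisfying $e_ie_j+e_je_i=-2\delta_{ij}$. Vectors are embedded as $\underline{x}=\sum_{j=1}^p x_je_j$, $\underline{y}=\sum_{j=1}^q y_je_{p+j}$, $\underline{s}=\sum_{j=1}^q s_je_{p+j}$. $\langle\cdot,\cdot\rangle$ is the Euclidean inner product, $S^{q-1}$ the unit sphere of $\mathbb{R}^q$, $\partial_{\underline{y}}=\sum_{j=1}^q e_{p+j}\partial_{y_j}$, $\Delta_{\underline{y}}=-\partial_{\underline{y}}^2=\sum_{j=1}^q\partial_{y_j}^2$. $J_\nu$ is the Bessel function $J_{\nu}(z)=\frac{z^\nu}{2^\nu}\sum_{j=0}^\infty\frac{(-1)^j z^{2j}}{j!\, 2^{2j}\,\Gamma(\nu+j+1)}$. The operator expression is formal and is interpreted through the power series of the Bessel functions, in which only integer powers of $\Delta_{\underline{y}}$ occur: $$\Big(\frac{|\underline{x}|}{2}\sqrt{\Delta_{\underline{y}}}\Big)^{-p/2}\Big(\frac{|\underline{x}|}{2}\sqrt{\Delta_{\underline{y}}}J_{\frac{p}{2}-1}(|\underline{x}|\sqrt{\Delta_{\underline{y}}})\Big)=\sum_{j=0}^\infty \frac{(-1)^j |\underline{x}|^{2j} \Delta_{\underline{y}}^j}{j!\, 2^{2j}\Gamma(\frac{p}{2}+j)},\qquad \Big(\frac{|\underline{x}|}{2}\sqrt{\Delta_{\underline{y}}}\Big)^{-p/2}J_{\frac{p}{2}}(|\underline{x}|\sqrt{\Delta_{\underline{y}}})=\sum_{j=0}^\infty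 \frac{(-1)^j |\underline{x}|^{2j} \Delta_{\underline{y}}^j}{j!\, 2^{2j}\Gamma(\frac{p}{2}+j+1)},$$ and $\underline{x}\,\partial_{\underline{y}}$ denotes applying $\partial_{\underline{y}}$ followed by left multiplication by $\underline{x}$. *)

theory Defs
  imports "HOL-Analysis.Analysis"
begin

instantiation sum :: (linorder, linorder) linorder
begin

text \<open>Lexicographic order: the generators indexed by the left summand come first.\<close>

definition less_eq_sum :: "'a + 'b \<Rightarrow> 'a + 'b \<Rightarrow> bool" where
  "less_eq_sum u v = (case u of
     Inl a \<Rightarrow> (case v of Inl b \<Rightarrow> a \<le> b | Inr _ \<Rightarrow> True)
   | Inr a \<Rightarrow> (case v of Inl _ \<Rightarrow> False | Inr b \<Rightarrow> a \<le> b))"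

definition less_sum :: "'a + 'b \<Rightarrow> 'a + 'b \<Rightarrow> bool" where
  "less_sum u v \<longleftrightarrow> u \<le> v \<and> \<not> v \<le> u"

instance
  by standard (auto simp: less_eq_sum_def less_sum_def split: sum.splits)

end


section \<open>The complex Clifford algebra\<close>

text \<open>
  An element is given by its complex coefficients with respect to the basis \<open>e\<^sub>A\<close>, where
  \<open>e\<^sub>A\<close> is the product of the \<open>e\<^sub>i\<close>, \<open>i \<in> A\<close>, in increasing order.  The complex dimension is
  therefore \<open>2 ^ CARD('n)\<close>.
\<close>

typedef (overloaded) ('n::finite) clifford = "UNIV :: (complex ^ ('n set)) set"
  morphisms coeffs Clifford ..

lemma clifford_eq_iff: "a = b \<longleftrightarrow> (\<forall>A. coeffs a $ A = coeffs b $ A)"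
  by (metis coeffs_inject vec_eq_iff)

lemma coeffs_Clifford [simp]: "coeffs (Clifford v) = v"
  by (simp add: Clifford_inverse)

text \<open>
  \<open>e\<^sub>A e\<^sub>B = clifford_sign A B e\<^sub>C\<close> with \<open>C\<close> the symmetric difference of \<open>A\<close> and \<open>B\<close>: every pair
  \<open>a > b\<close> costs one transposition of anticommuting generators, and every common index contributes
  \<open>e\<^sub>a\<^sup>2 = -1\<close>.
\<close>

definition clifford_sign :: "'n::{finite,linorder} set \<Rightarrow> 'n set \<Rightarrow> complex" where
  "clifford_sign A B = (\<Prod>a\<in>A. \<Prod>b\<in>B. if b \<le> a then -1 else 1)"

instantiation clifford :: (finite) real_vector
begin

definition zero_clifford :: "'a clifford" where "0 = Clifford 0"
definition plus_clifford :: "'a clifford \<Rightarrow> 'a clifford \<Rightarrow> 'a clifford" where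
  "a + b = Clifford (coeffs a + coeffs b)"
definition minus_clifford :: "'a clifford \<Rightarrow> 'a clifford \<Rightarrow> 'a clifford" where
  "a - b = Clifford (coeffs a - coeffs b)"
definition uminus_clifford :: "'a clifford \<Rightarrow> 'a clifford" where
  "- a = Clifford (- coeffs a)"
definition scaleR_clifford :: "real \<Rightarrow> 'a clifford \<Rightarrow> 'a clifford" where
  "r *\<^sub>R a = Clifford (r *\<^sub>R coeffs a)"
instance
  by standard (simp_all add: clifford_eq_iff zero_clifford_def plus_clifford_def
      minus_clifford_def uminus_clifford_def scaleR_clifford_def algebra_simps)

end

lemma coeffs_simps [simp]:
  "coeffs 0 = 0" "coeffs (a + b) = coeffs a + coeffs b" "coeffs (a - b) = coeffs a - coeffs b"
  "coeffs (- a) = - coeffs a" "coeffs (r *\<^sub>R a) = r *\<^sub>R coeffs a"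
  by (simp_all add: zero_clifford_def plus_clifford_def minus_clifford_def uminus_clifford_def
      scaleR_clifford_def)

instantiation clifford :: (finite) real_normed_vector
begin

definition norm_clifford :: "'a clifford \<Rightarrow> real" where
  "norm_clifford a = norm (coeffs a)"
definition dist_clifford :: "'a clifford \<Rightarrow> 'a clifford \<Rightarrow> real" where
  "dist_clifford a b = norm (a - b)"
definition sgn_clifford :: "'a clifford \<Rightarrow> 'a clifford" where
  "sgn_clifford a = inverse (norm a) *\<^sub>R a"
definition uniformity_clifford :: "('a clifford \<times> 'a clifford) filter" where
  "uniformity_clifford = (INF e\<in>{0<..}. principal {(a, b). dist a b < e})"
definition open_clifford :: "'a clifford set \<Rightarrow> bool" where
  "open_clifford U = (\<forall>a\<in>U. eventually (\<lambda>(a', b). a' = a \<longrightarrow> b \<in> U) uniformity)"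

instance
proof
  fix a b :: "'a clifford" and r :: real and U :: "'a clifford set"
  show "dist a b = norm (a - b)" "sgn a = inverse (norm a) *\<^sub>R a"
    by (simp_all add: dist_clifford_def sgn_clifford_def)
  show "(uniformity :: ('a clifford \<times> 'a clifford) filter)
      = (INF e\<in>{0<..}. principal {(a, b). dist a b < e})"
    by (rule uniformity_clifford_def)
  show "open U = (\<forall>a\<in>U. \<forall>\<^sub>F (a', b) in uniformity. a' = a \<longrightarrow> b \<in> U)"
    by (rule open_clifford_def)
  show "norm a = 0 \<longleftrightarrow> a = 0"
    by (metis coeffs_inject coeffs_simps(1) norm_clifford_def norm_eq_zero)
  show "norm (a + b) \<le> norm a + norm b" by (simp add: norm_clifford_def norm_triangle_ineq)
  show "norm (r *\<^sub>R a) = \<bar>r\<bar> * norm a" by (simp add: norm_clifford_def)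
qed

end

lemma prod_sym_diff_involutive:
  fixes g :: "'n::finite \<Rightarrow> 'b::comm_monoid_mult"
  assumes "\<And>a. g a * g a = 1"
  shows "prod g (sym_diff A B) = prod g A * prod g B"
proof -
  have 1: "prod g A = prod g (A - B) * prod g (A \<inter> B)"
    by (subst prod.union_disjoint [symmetric]) (auto intro!: prod.cong)
  have 2: "prod g B = prod g (B - A) * prod g (A \<inter> B)"
    by (subst prod.union_disjoint [symmetric]) (auto intro!: prod.cong)
  have 3: "prod g (A \<inter> B) * prod g (A \<inter> B) = 1"
    by (subst prod.distrib [symmetric]) (simp add: assms)
  have 4: "prod g (sym_diff A B) = prod g (A - B) * prod g (B - A)"
    by (subst prod.union_disjoint [symmetric]) auto
  have "prod g A * prod g B
      = prod g (A - B) * prod g (B - A) * (prod g (A \<inter> B) * prod g (A \<inter> B))"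
    unfolding 1 2 by (simp only: mult.assoc mult.commute mult.left_commute)
  then show ?thesis
    using 3 4 by simp
qed

lemma clifford_sign_sym_diff_left:
  "clifford_sign (sym_diff A B) C = clifford_sign A C * clifford_sign B C"
  unfolding clifford_sign_def
  by (rule prod_sym_diff_involutive) (simp flip: prod.distrib, auto intro!: prod.neutral)

lemma clifford_sign_sym_diff_right:
  "clifford_sign C (sym_diff A B) = clifford_sign C A * clifford_sign C B"
proof -
  have swap: "clifford_sign X Y = (\<Prod>b\<in>Y. \<Prod>a\<in>X. if b \<le> a then -1 else 1)" for X Y :: "'a set"
    unfolding clifford_sign_def by (rule prod.swap)
  show ?thesis
    unfolding swap
    by (rule prod_sym_diff_involutive) (simp flip: prod.distrib, auto intro!: prod.neutral)
qed

lemma clifford_sign_empty [simp]: "clifford_sign {} A = 1" "clifford_sign A {} = 1"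
  by (simp_all add: clifford_sign_def)

lemma sum_sym_diff_reindex:
  fixes f :: "'n::finite set \<Rightarrow> 'b::comm_monoid_add"
  shows "(\<Sum>A\<in>UNIV. f A) = (\<Sum>A\<in>UNIV. f (sym_diff A B))"
  by (rule sum.reindex_bij_witness [where i = "\<lambda>A. sym_diff A B" and j = "\<lambda>A. sym_diff A B"])
    (auto intro!: arg_cong [where f = f])

instantiation clifford :: ("{finite,linorder}") real_algebra_1
begin

text \<open>The coefficient of \<open>e\<^sub>C\<close> collects the pairs \<open>(A, B)\<close> with symmetric difference \<open>C\<close>.\<close>

definition times_clifford :: "'a clifford \<Rightarrow> 'a clifford \<Rightarrow> 'a clifford" where
  "a * b = Clifford (\<chi> C. \<Sum>A\<in>UNIV.
     clifford_sign A (sym_diff A C) * coeffs a $ A * coeffs b $ (sym_diff A C))"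

definition one_clifford :: "'a clifford" where
  "1 = Clifford (\<chi> A. if A = {} then 1 else 0)"

instance
proof
  fix a b c :: "'a clifford" and r :: real
  note d = times_clifford_def one_clifford_def
  show "(a + b) * c = a * c + b * c" "a * (b + c) = a * b + a * c"
    by (simp_all add: clifford_eq_iff d algebra_simps sum.distrib)
  show "r *\<^sub>R a * b = r *\<^sub>R (a * b)" "a * r *\<^sub>R b = r *\<^sub>R (a * b)"
    by (simp_all add: clifford_eq_iff d scaleR_sum_right mult.assoc)
  show "1 * a = a"
    by (simp add: clifford_eq_iff d if_distrib if_distribR mult.assoc cong: if_cong)
  have "sym_diff A C = {} \<longleftrightarrow> A = C" for A C :: "'a set" by auto
  then show "a * 1 = a"
    by (simp add: clifford_eq_iff d if_distrib if_distribR cong: if_cong)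
  show "(0 :: 'a clifford) \<noteq> 1"
    by (auto simp: clifford_eq_iff d)
  show "a * b * c = a * (b * c)"
    unfolding clifford_eq_iff
  proof
    fix D :: "'a set"
    let ?s = clifford_sign
    let ?a = "\<lambda>A. coeffs a $ A" and ?b = "\<lambda>A. coeffs b $ A" and ?c = "\<lambda>A. coeffs c $ A"
    have "coeffs (a * b * c) $ D = (\<Sum>E\<in>UNIV. \<Sum>A\<in>UNIV.
        ?s E (sym_diff E D) * (?s A (sym_diff A E) * ?a A * ?b (sym_diff A E)) * ?c (sym_diff E D))"
      by (simp add: d sum_distrib_left sum_distrib_right)
    also have "\<dots> = (\<Sum>A\<in>UNIV. \<Sum>E\<in>UNIV.
        ?s E (sym_diff E D) * (?s A (sym_diff A E) * ?a A * ?b (sym_diff A E)) * ?c (sym_diff E D))"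
      by (rule sum.swap)
    also have "\<dots> = (\<Sum>A\<in>UNIV. \<Sum>B\<in>UNIV.
        ?s (sym_diff B A) (sym_diff (sym_diff B A) D) *
        (?s A (sym_diff A (sym_diff B A)) * ?a A * ?b (sym_diff A (sym_diff B A))) *
        ?c (sym_diff (sym_diff B A) D))"
      by (intro sum.cong refl sum_sym_diff_reindex)
    also have "\<dots> = (\<Sum>A\<in>UNIV. \<Sum>B\<in>UNIV. ?s A (sym_diff A D) * ?a A *
        (?s B (sym_diff B (sym_diff A D)) * ?b B * ?c (sym_diff B (sym_diff A D))))"
    proof (intro sum.cong refl)
      fix A B :: "'a set"
      have e1: "sym_diff A (sym_diff B A) = B" by auto
      have e2: "sym_diff (sym_diff B A) D = sym_diff B (sym_diff A D)" by auto
      have e3: "?s A B * ?s A B = 1"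
        using clifford_sign_sym_diff_right [of A B B] by simp
      have "?s (sym_diff B A) (sym_diff B (sym_diff A D)) * ?s A B
          = ?s A (sym_diff A D) * ?s B (sym_diff B (sym_diff A D))"
        unfolding clifford_sign_sym_diff_left clifford_sign_sym_diff_right
        using e3 by (simp add: algebra_simps)
      then have "(?s (sym_diff B A) (sym_diff B (sym_diff A D)) * ?s A B) *
          (?a A * ?b B * ?c (sym_diff B (sym_diff A D)))
        = (?s A (sym_diff A D) * ?s B (sym_diff B (sym_diff A D))) *
          (?a A * ?b B * ?c (sym_diff B (sym_diff A D)))"
        by (rule arg_cong)
      then show "?s (sym_diff B A) (sym_diff (sym_diff B A) D) *
        (?s A (sym_diff A (sym_diff B A)) * ?a A * ?b (sym_diff A (sym_diff B A))) *
        ?c (sym_diff (sym_diff B A) D) = ?s A (sym_diff A D) * ?a A *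
        (?s B (sym_diff B (sym_diff A D)) * ?b B * ?c (sym_diff B (sym_diff A D)))"
        unfolding e1 e2 by (simp only: mult.assoc mult.commute mult.left_commute)
    qed
    also have "\<dots> = coeffs (a * (b * c)) $ D"
      by (simp add: d sum_distrib_left sum_distrib_right)
    finally show "coeffs (a * b * c) $ D = coeffs (a * (b * c)) $ D" .
  qed
qed

end

definition clifford_gen :: "'n::{finite,linorder} \<Rightarrow> 'n clifford" where
  "clifford_gen i = Clifford (\<chi> A. if A = {i} then 1 else 0)"

lemma clifford_gen_anticommute:
  "clifford_gen i * clifford_gen j + clifford_gen j * clifford_gen i
     = (if i = j then - 2 else 0)"
proof -
  have g: "coeffs (clifford_gen i * clifford_gen j) $ C
      = (if C = sym_diff {i} {j} then clifford_sign {i} {j} else 0)" for i j :: 'a and C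
  proof -
    have "coeffs (clifford_gen i * clifford_gen j) $ C
        = (\<Sum>A\<in>UNIV. if A = {i} then
            clifford_sign {i} (sym_diff {i} C) * (if sym_diff {i} C = {j} then 1 else 0) else 0)"
      unfolding times_clifford_def clifford_gen_def coeffs_Clifford vec_lambda_beta
      by (rule sum.cong) (simp_all only: refl if_True if_False split: if_split, simp_all)
    also have "\<dots> = clifford_sign {i} (sym_diff {i} C) * (if sym_diff {i} C = {j} then 1 else 0)"
      by (subst sum.delta) simp_all
    also have "\<dots> = (if C = sym_diff {i} {j} then clifford_sign {i} {j} else 0)"
    proof (cases "C = sym_diff {i} {j}")
      case True
      have "sym_diff {i} (sym_diff {i} {j}) = {j}" by blast
      with True show ?thesis by (simp only: if_True refl mult_1_right)
    next
      case False
      moreover have "C = sym_diff {i} (sym_diff {i} C)" by blast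
      ultimately have "sym_diff {i} C \<noteq> {j}" by metis
      with False show ?thesis by (simp only: if_False mult_zero_right)
    qed
    finally show ?thesis .
  qed
  have two: "coeffs (2 :: 'a clifford) $ C = (if C = {} then 2 else 0)" for C
    unfolding one_add_one [symmetric] by (simp add: one_clifford_def)
  show ?thesis
  proof (cases "i = j")
    case True
    then show ?thesis
      by (simp add: clifford_eq_iff g two clifford_sign_def)
  next
    case False
    have "sym_diff {j} {i} = sym_diff {i} {j}" by blast
    moreover have "clifford_sign {i} {j} + clifford_sign {j} {i} = 0"
      using False by (auto simp: clifford_sign_def)
    ultimately show ?thesis
      using False by (simp only: clifford_eq_iff g coeffs_simps vector_add_component) simp
  qed
qed


section \<open>Vector variables and differential operators\<close>

text \<open>
  The generators of \<open>\<complex>\<^sub>p\<^sub>+\<^sub>q\<close> are indexed by \<open>'p + 'q\<close> with \<open>p = CARD('p)\<close> and \<open>q = CARD('q)\<close>;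
  \<open>Inl j\<close> corresponds to \<open>e\<^sub>j\<close> and \<open>Inr j\<close> to \<open>e\<close> with index \<open>p + j\<close>.
\<close>

definition vec_l :: "real ^ 'p::{finite,linorder} \<Rightarrow> ('p::{finite,linorder} + 'q::{finite,linorder}) clifford" where
  "vec_l x = (\<Sum>j\<in>UNIV. (x $ j) *\<^sub>R clifford_gen (Inl j))"

definition vec_r :: "real ^ 'q::{finite,linorder} \<Rightarrow> ('p::{finite,linorder} + 'q::{finite,linorder}) clifford" where
  "vec_r y = (\<Sum>j\<in>UNIV. (y $ j) *\<^sub>R clifford_gen (Inr j))"

definition partial :: "'q \<Rightarrow> (real ^ 'q::finite \<Rightarrow> 'a::real_normed_vector) \<Rightarrow> real ^ 'q \<Rightarrow> 'a" where
  "partial j g y = vector_derivative (\<lambda>t. g (y + t *\<^sub>R axis j 1)) (at 0)"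

definition dirac_r :: "(real ^ 'q::{finite,linorder} \<Rightarrow> ('p::{finite,linorder} + 'q::{finite,linorder}) clifford)
    \<Rightarrow> real ^ 'q::{finite,linorder} \<Rightarrow> ('p + 'q) clifford" where
  "dirac_r g y = (\<Sum>j\<in>UNIV. clifford_gen (Inr j) * partial j g y)"

definition laplacian :: "(real ^ 'q::finite \<Rightarrow> 'a::real_normed_vector) \<Rightarrow> real ^ 'q \<Rightarrow> 'a" where
  "laplacian g y = (\<Sum>j\<in>UNIV. partial j (partial j g) y)"


section \<open>Bessel functions and the generalized Cauchy-Kovalevskaya extension\<close>

text \<open>Only nonnegative real arguments are needed; there \<open>powr\<close> is the usual real power.\<close>

definition bessel_J :: "real \<Rightarrow> real \<Rightarrow> real" where
  "bessel_J \<nu> z = z powr \<nu> / 2 powr \<nu> *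
     (\<Sum>j. (-1) ^ j * z ^ (2 * j) / (fact j * 2 ^ (2 * j) * Gamma (\<nu> + real j + 1)))"

text \<open>
  \<open>bessel_op \<nu> r\<close> is the operator \<open>(r/2 \<surd>\<Delta>)\<^sup>-\<^sup>\<nu> J\<^sub>\<nu>(r \<surd>\<Delta>)\<close>, read as a power series in \<open>\<Delta>\<close>.  Since
  \<open>(r/2 \<surd>\<Delta>)\<^sup>-\<^sup>p\<^sup>/\<^sup>2 (r/2 \<surd>\<Delta>) = (r/2 \<surd>\<Delta>)\<^sup>-\<^sup>\<nu>\<close> for \<open>\<nu> = p/2 - 1\<close>, both operators in the extension
  formula are of this form, with \<open>\<nu> = p/2 - 1\<close> and \<open>\<nu> = p/2\<close>.
\<close>

definition bessel_op_term ::
  "real \<Rightarrow> real \<Rightarrow> (real ^ 'q::finite \<Rightarrow> 'a::real_normed_vector) \<Rightarrow> real ^ 'q \<Rightarrow> nat \<Rightarrow> 'a" where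
  "bessel_op_term \<nu> r g y j =
     ((-1) ^ j * r ^ (2 * j) / (fact j * 2 ^ (2 * j) * Gamma (\<nu> + real j + 1)))
       *\<^sub>R (laplacian ^^ j) g y"

definition bessel_op ::
  "real \<Rightarrow> real \<Rightarrow> (real ^ 'q::finite \<Rightarrow> 'a::real_normed_vector) \<Rightarrow> real ^ 'q \<Rightarrow> 'a" where
  "bessel_op \<nu> r g y = (\<Sum>j. bessel_op_term \<nu> r g y j)"

definition GCK :: "(real ^ 'q::{finite,linorder} \<Rightarrow> ('p::{finite,linorder} + 'q::{finite,linorder}) clifford)
    \<Rightarrow> real ^ 'p::{finite,linorder} \<Rightarrow> real ^ 'q::{finite,linorder} \<Rightarrow> ('p + 'q) clifford" where
  "GCK f0 x y = Gamma (real CARD('p) / 2) *\<^sub>R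
     (bessel_op (real CARD('p) / 2 - 1) (norm x) f0 y
      + (1 / 2) *\<^sub>R (vec_l x * dirac_r (bessel_op (real CARD('p) / 2) (norm x) f0) y))"

text \<open>The formula for the plane wave; it is meaningful for \<open>x \<noteq> 0\<close> only.\<close>

definition plane_wave :: "real ^ 'q::{finite,linorder} \<Rightarrow> real ^ 'p::{finite,linorder} \<Rightarrow> real ^ 'q::{finite,linorder}
    \<Rightarrow> ('p::{finite,linorder} + 'q::{finite,linorder}) clifford" where
  "plane_wave s x y =
     (2 powr (real CARD('p) / 2 - 1) * Gamma (real CARD('p) / 2)
        / norm x powr (real CARD('p) / 2 - 1)) *\<^sub>R
     ((of_real (bessel_J (real CARD('p) / 2 - 1) (norm x))
       + bessel_J (real CARD('p) / 2) (norm x) *\<^sub>R (vec_l x /\<^sub>R norm x * vec_r s))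
      * of_real (exp (y \<bullet> s)))"

end

theory Submission
  imports Defs
begin

text \<open>
  Fix \<open>s\<close> with \<open>|s| = 1\<close>.  The exponential \<open>exp (y \<bullet> s)\<close> is an eigenfunction of every partial
  derivative \<open>\<partial>\<^sub>j\<close>, with eigenvalue \<open>s\<^sub>j\<close>, hence of the Laplacian with eigenvalue \<open>|s|\<^sup>2 = 1\<close>.  A power
  series in the Laplacian therefore acts on it as multiplication by the value of the series at \<open>1\<close>,
  which turns the operator \<open>(r/2 \<surd>\<Delta>)\<^sup>-\<^sup>\<nu> J\<^sub>\<nu>(r \<surd>\<Delta>)\<close> into the number \<open>(r/2)\<^sup>-\<^sup>\<nu> J\<^sub>\<nu>(r)\<close>
  (\<open>bessel_op_exponential\<close>), while the Dirac operator becomes left multiplication by the vector \<open>s\<close>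
  (\<open>dirac_r_exponential\<close>).  This evaluates the extension to
  \<open>\<Gamma>(\<nu> + 1) (E\<^sub>\<nu>(|x|) + \<onehalf> E\<^sub>\<nu>\<^sub>+\<^sub>1(|x|) x s) exp (y \<bullet> s)\<close>, where \<open>\<nu> = p/2 - 1\<close> and
  \<open>E\<^sub>\<nu>(z) = (z/2)\<^sup>-\<^sup>\<nu> J\<^sub>\<nu>(z)\<close>.

  For \<open>x \<noteq> 0\<close> the powers of \<open>|x|\<close> in the plane wave cancel against those in the Bessel functions and
  leave the same expression.  Since \<open>p \<ge> 1\<close>, the orders \<open>p/2 - 1\<close> and \<open>p/2\<close> exceed \<open>-1\<close>, and for
  such orders \<open>E\<^sub>\<nu>\<close> is an everywhere convergent power series in \<open>z\<^sup>2\<close>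
  (\<open>summable_bessel_entire\<close>).  So the expression is continuous in \<open>x\<close>, and its value at \<open>x = 0\<close> is
  the limit of the plane wave.
\<close>


section \<open>The entire part of the Bessel function\<close>

definition bessel_coeff :: "real \<Rightarrow> nat \<Rightarrow> real" where
  "bessel_coeff \<nu> j = (-1) ^ j / (fact j * 2 ^ (2 * j) * Gamma (\<nu> + real j + 1))"

text \<open>The function \<open>(z/2)\<^sup>-\<^sup>\<nu> J\<^sub>\<nu>(z)\<close>, extended through the removable singularity at \<open>0\<close>.\<close>

definition bessel_entire :: "real \<Rightarrow> real \<Rightarrow> real" where
  "bessel_entire \<nu> z = (\<Sum>j. bessel_coeff \<nu> j * (z\<^sup>2) ^ j)"

lemma bessel_J_eq_bessel_entire:
  "bessel_J \<nu> z = z powr \<nu> / 2 powr \<nu> * bessel_entire \<nu> z"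
  by (simp add: bessel_J_def bessel_entire_def bessel_coeff_def power_mult)

text \<open>
  From argument \<open>1\<close> on, \<open>\<Gamma>(x + 1) = x \<Gamma>(x)\<close> makes \<open>\<Gamma>\<close> grow along steps of length one.  The first
  step, from \<open>\<nu> + 1\<close> to \<open>\<nu> + 2\<close>, starts below \<open>1\<close> when \<open>\<nu> < 0\<close> and may decrease \<open>\<Gamma>\<close> (as for
  \<open>\<nu> = -1/2\<close>); this is why the bound is based at \<open>\<nu> + 2\<close>.
\<close>

lemma Gamma_shift_ge:
  fixes \<nu> :: real
  assumes "\<nu> > -1"
  shows "Gamma (\<nu> + 2) \<le> Gamma (\<nu> + real (Suc j) + 1)"
proof (induction j)
  case (Suc j)
  let ?x = "\<nu> + real (Suc j) + 1"
  have "Gamma ?x \<le> ?x * Gamma ?x"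
    using assms by (simp add: Gamma_real_pos less_imp_le)
  also have "\<dots> = Gamma (?x + 1)"
    using assms by (subst Gamma_plus1) (auto elim!: nonpos_Ints_cases)
  finally show ?case
    using Suc by (simp add: algebra_simps)
qed (simp add: algebra_simps)

text \<open>
  As \<open>1 / \<Gamma>(\<nu> + j + 1)\<close> stays bounded, the series is dominated by a multiple of the exponential
  series at \<open>|t| / 4\<close>.
\<close>

lemma summable_bessel_entire:
  assumes "\<nu> > -1"
  shows "summable (\<lambda>j. bessel_coeff \<nu> j * t ^ j)"
proof (rule summable_comparison_test')
  show "summable (\<lambda>j. inverse (Gamma (\<nu> + 2)) * (inverse (fact j) * (\<bar>t\<bar> / 4) ^ j))"
    by (intro summable_mult summable_exp)
  fix j :: nat
  assume "1 \<le> j"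
  then obtain i where j: "j = Suc i" by (cases j) auto
  have G: "0 < Gamma (\<nu> + 2)" "Gamma (\<nu> + 2) \<le> Gamma (\<nu> + real j + 1)"
    using assms Gamma_shift_ge[of \<nu> i] unfolding j by (auto intro!: Gamma_real_pos)
  have four: "(2 :: real) ^ (2 * j) = 4 ^ j"
    by (simp add: power_mult)
  have "norm (bessel_coeff \<nu> j * t ^ j)
      = inverse (Gamma (\<nu> + real j + 1)) * (inverse (fact j) * (\<bar>t\<bar> / 4) ^ j)"
    using G unfolding bessel_coeff_def four
    by (simp add: abs_mult power_abs power_divide field_simps)
  also have "\<dots> \<le> inverse (Gamma (\<nu> + 2)) * (inverse (fact j) * (\<bar>t\<bar> / 4) ^ j)"
    using G by (intro mult_right_mono le_imp_inverse_le) auto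
  finally show "norm (bessel_coeff \<nu> j * t ^ j)
      \<le> inverse (Gamma (\<nu> + 2)) * (inverse (fact j) * (\<bar>t\<bar> / 4) ^ j)" .
qed

lemma isCont_bessel_entire:
  assumes "\<nu> > -1"
  shows "isCont (bessel_entire \<nu>) z"
proof -
  have "isCont (\<lambda>t. \<Sum>j. bessel_coeff \<nu> j * t ^ j) (z\<^sup>2)"
    by (rule isCont_powser_converges_everywhere) (rule summable_bessel_entire[OF assms])
  then have "isCont (\<lambda>z. \<Sum>j. bessel_coeff \<nu> j * (z\<^sup>2) ^ j) z"
    by (rule isCont_o2[rotated]) (intro continuous_intros)
  then show ?thesis
    by (simp add: bessel_entire_def[abs_def])
qed


section \<open>Exponentials as eigenfunctions\<close>

text \<open>
  The amplitude \<open>c\<close> is arbitrary, so that the class of functions \<open>exp (y \<bullet> s) c\<close> is preserved by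
  the operators below and they can be iterated and composed.
\<close>

lemma partial_exponential:
  "partial j (\<lambda>y. exp (y \<bullet> s) *\<^sub>R c) = (\<lambda>y. exp (y \<bullet> s) *\<^sub>R ((s $ j) *\<^sub>R c))"
proof
  fix y :: "real ^ 'a"
  have "((\<lambda>t. exp ((y + t *\<^sub>R axis j 1) \<bullet> s)) has_real_derivative exp (y \<bullet> s) * s $ j) (at 0)"
    unfolding inner_add_left inner_scaleR_left inner_axis'
    by (auto intro!: derivative_eq_intros)
  then have "((\<lambda>t. exp ((y + t *\<^sub>R axis j 1) \<bullet> s) *\<^sub>R c)
      has_vector_derivative (exp (y \<bullet> s) * s $ j) *\<^sub>R c) (at 0)"
    unfolding has_real_derivative_iff_has_vector_derivative
    by (rule bounded_linear.has_vector_derivative[OF bounded_linear_scaleR_left])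
  then show "partial j (\<lambda>y. exp (y \<bullet> s) *\<^sub>R c) y = exp (y \<bullet> s) *\<^sub>R ((s $ j) *\<^sub>R c)"
    unfolding partial_def by (simp add: vector_derivative_at)
qed

lemma laplacian_exponential:
  "laplacian (\<lambda>y. exp (y \<bullet> s) *\<^sub>R c) = (\<lambda>y. exp (y \<bullet> s) *\<^sub>R ((norm s)\<^sup>2 *\<^sub>R c))"
proof
  fix y
  have "laplacian (\<lambda>y. exp (y \<bullet> s) *\<^sub>R c) y = (\<Sum>j\<in>UNIV. exp (y \<bullet> s) *\<^sub>R ((s $ j * s $ j) *\<^sub>R c))"
    unfolding laplacian_def partial_exponential by simp
  also have "\<dots> = exp (y \<bullet> s) *\<^sub>R ((norm s)\<^sup>2 *\<^sub>R c)"
    by (simp add: power2_norm_eq_inner inner_vec_def scaleR_sum_left scaleR_sum_right)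
  finally show "laplacian (\<lambda>y. exp (y \<bullet> s) *\<^sub>R c) y = exp (y \<bullet> s) *\<^sub>R ((norm s)\<^sup>2 *\<^sub>R c)" .
qed

lemma laplacian_funpow_exponential:
  "(laplacian ^^ n) (\<lambda>y. exp (y \<bullet> s) *\<^sub>R c) = (\<lambda>y. exp (y \<bullet> s) *\<^sub>R (((norm s)\<^sup>2) ^ n *\<^sub>R c))"
proof (induction n)
  case (Suc n)
  have "(laplacian ^^ Suc n) (\<lambda>y. exp (y \<bullet> s) *\<^sub>R c)
      = laplacian (\<lambda>y. exp (y \<bullet> s) *\<^sub>R (((norm s)\<^sup>2) ^ n *\<^sub>R c))"
    by (simp only: funpow.simps o_apply Suc.IH)
  then show ?case
    unfolding laplacian_exponential by simp
qed simp

text \<open>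
  Each Laplacian comes with a factor \<open>r\<^sup>2\<close>, so its eigenvalue \<open>|s|\<^sup>2\<close> only rescales \<open>r\<close> to \<open>r |s|\<close>.
\<close>

lemma bessel_op_term_exponential:
  "bessel_op_term \<nu> r (\<lambda>y. exp (y \<bullet> s) *\<^sub>R c) y
     = (\<lambda>j. (bessel_coeff \<nu> j * ((r * norm s)\<^sup>2) ^ j) *\<^sub>R (exp (y \<bullet> s) *\<^sub>R c))"
  by (rule ext) (simp add: bessel_op_term_def laplacian_funpow_exponential bessel_coeff_def
      power_mult_distrib mult_ac flip: power_mult)

lemma summable_bessel_op_term_exponential:
  assumes "\<nu> > -1"
  shows "summable (bessel_op_term \<nu> r (\<lambda>y. exp (y \<bullet> s) *\<^sub>R c) y)"
  unfolding bessel_op_term_exponential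
  by (intro bounded_linear.summable[OF bounded_linear_scaleR_left] summable_bessel_entire assms)

lemma bessel_op_exponential:
  assumes "\<nu> > -1"
  shows "bessel_op \<nu> r (\<lambda>y. exp (y \<bullet> s) *\<^sub>R c)
     = (\<lambda>y. exp (y \<bullet> s) *\<^sub>R (bessel_entire \<nu> (r * norm s) *\<^sub>R c))"
proof
  fix y
  have "bessel_op \<nu> r (\<lambda>y. exp (y \<bullet> s) *\<^sub>R c) y
      = bessel_entire \<nu> (r * norm s) *\<^sub>R (exp (y \<bullet> s) *\<^sub>R c)"
    unfolding bessel_op_def bessel_op_term_exponential bessel_entire_def
    by (intro bounded_linear.suminf[OF bounded_linear_scaleR_left, symmetric]
        summable_bessel_entire assms)
  then show "bessel_op \<nu> r (\<lambda>y. exp (y \<bullet> s) *\<^sub>R c) y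
      = exp (y \<bullet> s) *\<^sub>R (bessel_entire \<nu> (r * norm s) *\<^sub>R c)"
    by (simp add: mult.commute)
qed

lemma dirac_r_exponential:
  "dirac_r (\<lambda>y. exp (y \<bullet> s) *\<^sub>R c) y = exp (y \<bullet> s) *\<^sub>R (vec_r s * c)"
  by (simp add: dirac_r_def partial_exponential vec_r_def sum_distrib_right scaleR_sum_right)


section \<open>The extension and the plane wave\<close>

text \<open>
  For \<open>|s| = 1\<close> this is the extension at every \<open>x\<close>, and it is the plane wave wherever \<open>x \<noteq> 0\<close>.  As
  it involves no division by \<open>|x|\<close>, it mediates between the two at \<open>x = 0\<close>.
\<close>

definition regular_plane_wave ::
  "real ^ 'q::{finite,linorder} \<Rightarrow> real ^ 'p::{finite,linorder} \<Rightarrow> real ^ 'q::{finite,linorder}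
    \<Rightarrow> ('p::{finite,linorder} + 'q::{finite,linorder}) clifford" where
  "regular_plane_wave s x y = (Gamma (real CARD('p) / 2) * exp (y \<bullet> s)) *\<^sub>R
     (bessel_entire (real CARD('p) / 2 - 1) (norm x) *\<^sub>R 1
      + (bessel_entire (real CARD('p) / 2) (norm x) / 2) *\<^sub>R (vec_l x * vec_r s))"

lemma GCK_exponential:
  fixes s :: "real ^ 'q::{finite,linorder}" and x :: "real ^ 'p::{finite,linorder}"
  assumes "norm s = 1"
  shows "GCK (\<lambda>y. of_real (exp (y \<bullet> s))) x y = regular_plane_wave s x y"
proof -
  have orders: "real CARD('p) / 2 - 1 > -1" "real CARD('p) / 2 > -1"
    by (simp_all add: less_le_trans[of "-1" 0])
  show ?thesis
    unfolding of_real_def GCK_def regular_plane_wave_def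
      bessel_op_exponential[OF orders(1)] bessel_op_exponential[OF orders(2)] dirac_r_exponential
    by (simp add: assms scaleR_add_right mult_ac)
qed

lemma plane_wave_eq_regular_plane_wave:
  fixes s :: "real ^ 'q::{finite,linorder}" and x :: "real ^ 'p::{finite,linorder}"
  assumes "x \<noteq> 0"
  shows "plane_wave s x y = regular_plane_wave s x y"
proof -
  define \<nu> where "\<nu> = real CARD('p) / 2 - 1"
  define r where "r = norm x"
  define G where "G = Gamma (real CARD('p) / 2)"
  have r: "r > 0" using assms by (simp add: r_def)
  have \<nu>1: "real CARD('p) / 2 = \<nu> + 1" by (simp add: \<nu>_def)
  have even_part: "2 powr \<nu> * G / r powr \<nu> * bessel_J \<nu> r = G * bessel_entire \<nu> r"
    using r by (simp add: bessel_J_eq_bessel_entire)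
  have odd_part: "2 powr \<nu> * G / r powr \<nu> * (bessel_J (\<nu> + 1) r / r)
      = G * (bessel_entire (\<nu> + 1) r / 2)"
    using r by (simp add: bessel_J_eq_bessel_entire powr_add)
  have "plane_wave s x y = exp (y \<bullet> s) *\<^sub>R
      ((2 powr \<nu> * G / r powr \<nu> * bessel_J \<nu> r) *\<^sub>R 1
       + (2 powr \<nu> * G / r powr \<nu> * (bessel_J (\<nu> + 1) r / r)) *\<^sub>R (vec_l x * vec_r s))"
    unfolding plane_wave_def of_real_def r_def[symmetric] \<nu>_def[symmetric] G_def[symmetric]
    unfolding \<nu>1
    by (simp add: scaleR_add_right divide_inverse mult_ac)
  also have "\<dots> = regular_plane_wave s x y"
    unfolding even_part odd_part regular_plane_wave_def
      r_def[symmetric] \<nu>_def[symmetric] G_def[symmetric]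
    unfolding \<nu>1
    by (simp add: scaleR_add_right mult_ac)
  finally show ?thesis .
qed

lemma isCont_regular_plane_wave:
  fixes s :: "real ^ 'q::{finite,linorder}" and x :: "real ^ 'p::{finite,linorder}"
  shows "isCont (\<lambda>x :: real ^ 'p::{finite,linorder}. regular_plane_wave s x y) x"
proof -
  have orders: "real CARD('p) / 2 - 1 > -1" "real CARD('p) / 2 > -1"
    by (simp_all add: less_le_trans[of "-1" 0])
  have E: "isCont (\<lambda>x :: real ^ 'p::{finite,linorder}. bessel_entire \<nu> (norm x)) x" if "\<nu> > -1" for \<nu>
    by (rule isCont_o2[OF _ isCont_bessel_entire[OF that]]) (intro continuous_intros)
  \<comment> \<open>The product is expanded in the coordinates of \<open>x\<close>, so that only real scalars vary with \<open>x\<close>.\<close>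
  have "isCont (\<lambda>x :: real ^ 'p::{finite,linorder}. vec_l x * vec_r s :: ('p + 'q) clifford) x"
    unfolding vec_l_def sum_distrib_right mult_scaleR_left isCont_def by (intro tendsto_intros)
  then show ?thesis
    unfolding regular_plane_wave_def
    by (intro continuous_intros E[OF orders(1)] E[OF orders(2)]) auto
qed

theorem proposition6p2:
  fixes s :: "real ^ 'q::{finite,linorder}"
    and f0 :: "real ^ 'q::{finite,linorder} \<Rightarrow> ('p::{finite,linorder} + 'q) clifford"
  assumes s: "s \<in> sphere 0 1"
    and f0: "f0 = (\<lambda>y. of_real (exp (y \<bullet> s)))"
  shows "(\<forall>(x :: real ^ 'p::{finite,linorder}) y.
            summable (bessel_op_term (real CARD('p) / 2 - 1) (norm x) f0 y) \<and>
            summable (bessel_op_term (real CARD('p) / 2) (norm x) f0 y)) \<and>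
         (\<forall>(x :: real ^ 'p::{finite,linorder}) y. x \<noteq> 0 \<longrightarrow> GCK f0 x y = plane_wave s x y) \<and>
         (\<forall>y. ((\<lambda>x :: real ^ 'p::{finite,linorder}. plane_wave s x y) \<longlongrightarrow> GCK f0 0 y) (at 0))"
proof (intro conjI allI impI)
  have norm_s: "norm s = 1"
    using s by simp
  have f0_exponential: "f0 = (\<lambda>y. exp (y \<bullet> s) *\<^sub>R 1)"
    by (simp add: f0 of_real_def)
  show "summable (bessel_op_term (real CARD('p) / 2 - 1) (norm x) f0 y)"
    for x :: "real ^ 'p::{finite,linorder}" and y
    unfolding f0_exponential by (rule summable_bessel_op_term_exponential) simp
  show "summable (bessel_op_term (real CARD('p) / 2) (norm x) f0 y)"
    for x :: "real ^ 'p::{finite,linorder}" and y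
    unfolding f0_exponential
    by (rule summable_bessel_op_term_exponential) (simp add: less_le_trans[of "-1" 0])
  show "GCK f0 x y = plane_wave s x y" if "x \<noteq> 0" for x :: "real ^ 'p::{finite,linorder}" and y
    by (simp add: f0 GCK_exponential[OF norm_s] plane_wave_eq_regular_plane_wave[OF that])
  show "((\<lambda>x :: real ^ 'p::{finite,linorder}. plane_wave s x y) \<longlongrightarrow> GCK f0 0 y) (at 0)" for y
  proof (rule Lim_transform_eventually)
    show "((\<lambda>x :: real ^ 'p::{finite,linorder}. regular_plane_wave s x y) \<longlongrightarrow> GCK f0 0 y) (at 0)"
      using isCont_regular_plane_wave[where s = s and y = y and x = 0]
      by (simp add: f0 GCK_exponential[OF norm_s] isCont_def)
    show "\<forall>\<^sub>F x in at (0 :: real ^ 'p::{finite,linorder}). regular_plane_wave s x y = plane_wave s x y"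
      by (auto simp: eventually_at_filter plane_wave_eq_regular_plane_wave)
  qed
qed

end
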